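(* For every integer $n\geq 8$, the set $\mathcal{F}_{\mathrm{fin}}(n)$ is not closed in $\mathbb{M}_n(\mathbb{C})$.
   Context: For a positive integer $n$, $\mathcal{F}_{\mathrm{fin}}(n)$ denotes the set of all $n\times n$ complex matrices $(a_{ij})_{1\leq i,j\leq n}$ for which there exist a finite-dimensional von Neumann algebra $\mathcal{M}$ with a faithful tracial state $\tau$ and unitaries $U_1,\dots,U_n\in\mathcal{M}$ such that $a_{ij}=\tau(U_j^*U_i)$ for all $1\leq i,j\leq n$. *)

theory Defs
  imports "HOL-Analysis.Analysis"
begin

type_synonym cmat = "nat \<Rightarrow> nat \<Rightarrow> complex"

definition mats :: "nat \<Rightarrow> cmat set" where
  "mats N = {A. \<forall>i j. (N \<le> i \<or> N \<le> j) \<longrightarrow> A i j = 0}"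

definition mmult :: "nat \<Rightarrow> cmat \<Rightarrow> cmat \<Rightarrow> cmat" where
  "mmult N A B = (\<lambda>i j. \<Sum>k<N. A i k * B k j)"

definition madj :: "cmat \<Rightarrow> cmat" where
  "madj A = (\<lambda>i j. cnj (A j i))"

definition mone :: "nat \<Rightarrow> cmat" where
  "mone N = (\<lambda>i j. if i = j \<and> i < N then 1 else 0)"

definition madd :: "cmat \<Rightarrow> cmat \<Rightarrow> cmat" where
  "madd A B = (\<lambda>i j. A i j + B i j)"

definition mscale :: "complex \<Rightarrow> cmat \<Rightarrow> cmat" where
  "mscale c A = (\<lambda>i j. c * A i j)"

text \<open>A finite-dimensional von Neumann algebra, realised concretely as a unital
  *-subalgebra of M_N(C) (every finite-dimensional von Neumann algebra is
  *-isomorphic to one, and every such subalgebra is a von Neumann algebra).\<close>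

definition unital_star_subalg :: "nat \<Rightarrow> cmat set \<Rightarrow> bool" where
  "unital_star_subalg N M \<longleftrightarrow>
     M \<subseteq> mats N \<and> mone N \<in> M \<and>
     (\<forall>x\<in>M. \<forall>y\<in>M. madd x y \<in> M) \<and>
     (\<forall>c. \<forall>x\<in>M. mscale c x \<in> M) \<and>
     (\<forall>x\<in>M. \<forall>y\<in>M. mmult N x y \<in> M) \<and>
     (\<forall>x\<in>M. madj x \<in> M)"

definition faithful_tracial_state :: "nat \<Rightarrow> cmat set \<Rightarrow> (cmat \<Rightarrow> complex) \<Rightarrow> bool" where
  "faithful_tracial_state N M \<tau> \<longleftrightarrow>
     (\<forall>x\<in>M. \<forall>y\<in>M. \<tau> (madd x y) = \<tau> x + \<tau> y) \<and>
     (\<forall>c. \<forall>x\<in>M. \<tau> (mscale c x) = c * \<tau> x) \<and>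
     \<tau> (mone N) = 1 \<and>
     (\<forall>x\<in>M. Im (\<tau> (mmult N (madj x) x)) = 0 \<and> Re (\<tau> (mmult N (madj x) x)) \<ge> 0) \<and>
     (\<forall>x\<in>M. \<forall>y\<in>M. \<tau> (mmult N x y) = \<tau> (mmult N y x)) \<and>
     (\<forall>x\<in>M. \<tau> (mmult N (madj x) x) = 0 \<longrightarrow> x = (\<lambda>i j. 0))"

definition unitary_in :: "nat \<Rightarrow> cmat set \<Rightarrow> cmat \<Rightarrow> bool" where
  "unitary_in N M U \<longleftrightarrow> U \<in> M \<and> mmult N (madj U) U = mone N \<and> mmult N U (madj U) = mone N"

definition F_fin :: "(complex ^ 'n ^ 'n) set" where
  "F_fin = {a. \<exists>N M \<tau> (U :: 'n \<Rightarrow> cmat).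
      unital_star_subalg N M \<and> faithful_tracial_state N M \<tau> \<and>
      (\<forall>i. unitary_in N M (U i)) \<and>
      (\<forall>i j. a $ i $ j = \<tau> (mmult N (madj (U j)) (U i)))}"

end

(* For unitaries U, X the matrix (U + i X) / sqrt 2 is unitary exactly when U^* X and X U^* are
   Hermitian.
   A Gram matrix of unitaries determines the linear relations among them, so the Gram matrix of
   eight unitaries U_0, ..., U_3, V_0, ..., V_3 can encode V_r = (U_r + i U_(r+1)) / sqrt 2 for
   r < 3 and V_3 = (U_3 + i z U_0) / sqrt 2.  Then U_0^* U_1, U_1^* U_2, U_2^* U_3 and z U_3^* U_0
   are four symmetries with product z, which by taking determinants is impossible in M_N(C) unless
   z^(2N) = 1.  For z a root of unity such symmetries do exist, and a limit of Gram matrices along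
   roots of unity converging to z = cis (pi t) with t irrational is not in F_fin. *)

theory Submission
  imports Defs "Jordan_Normal_Form.Determinant"
begin

section \<open>Matrix algebra\<close>

lemma mats_mmult: "A \<in> mats N \<Longrightarrow> B \<in> mats N \<Longrightarrow> mmult N A B \<in> mats N"
  by (auto simp: mats_def mmult_def intro!: sum.neutral)

lemma mats_madj: "A \<in> mats N \<Longrightarrow> madj A \<in> mats N"
  by (auto simp: mats_def madj_def)

lemma mats_mone: "mone N \<in> mats N"
  by (auto simp: mats_def mone_def)

lemma mats_madd: "A \<in> mats N \<Longrightarrow> B \<in> mats N \<Longrightarrow> madd A B \<in> mats N"
  by (auto simp: mats_def madd_def)

lemma mats_mscale: "A \<in> mats N \<Longrightarrow> mscale c A \<in> mats N"
  by (auto simp: mats_def mscale_def)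

lemma mmult_assoc: "mmult N (mmult N A B) C = mmult N A (mmult N B C)"
proof (intro ext)
  fix i j
  have "(\<Sum>k<N. (\<Sum>l<N. A i l * B l k) * C k j) = (\<Sum>k<N. \<Sum>l<N. A i l * (B l k * C k j))"
    by (simp add: sum_distrib_right mult.assoc)
  also have "\<dots> = (\<Sum>l<N. \<Sum>k<N. A i l * (B l k * C k j))"
    by (rule sum.swap)
  finally show "mmult N (mmult N A B) C i j = mmult N A (mmult N B C) i j"
    by (simp add: mmult_def sum_distrib_left)
qed

lemma mmult_mone_left: "A \<in> mats N \<Longrightarrow> mmult N (mone N) A = A"
proof (intro ext)
  fix i j assume A: "A \<in> mats N"
  have "mmult N (mone N) A i j = (\<Sum>k<N. if i = k then A k j else 0)"
    unfolding mmult_def mone_def by (intro sum.cong) auto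
  also have "\<dots> = A i j"
    using A by (auto simp: mats_def)
  finally show "mmult N (mone N) A i j = A i j" .
qed

lemma madj_madj: "madj (madj A) = A"
  by (simp add: madj_def)

lemma madj_mmult: "madj (mmult N A B) = mmult N (madj B) (madj A)"
  by (simp add: madj_def mmult_def mult.commute)

lemma madj_mone: "madj (mone N) = mone N"
  by (intro ext) (auto simp: madj_def mone_def)

lemma mmult_mone_right: "A \<in> mats N \<Longrightarrow> mmult N A (mone N) = A"
  by (metis madj_madj madj_mmult madj_mone mats_madj mmult_mone_left)

lemma madj_madd: "madj (madd A B) = madd (madj A) (madj B)"
  by (simp add: madj_def madd_def)

lemma madj_mscale: "madj (mscale c A) = mscale (cnj c) (madj A)"
  by (simp add: madj_def mscale_def)

lemma mmult_madd_left: "mmult N (madd A B) C = madd (mmult N A C) (mmult N B C)"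
  by (simp add: mmult_def madd_def algebra_simps sum.distrib)

lemma mmult_madd_right: "mmult N A (madd B C) = madd (mmult N A B) (mmult N A C)"
  by (simp add: mmult_def madd_def algebra_simps sum.distrib)

lemma mmult_mscale_left: "mmult N (mscale c A) B = mscale c (mmult N A B)"
  by (simp add: mmult_def mscale_def sum_distrib_left mult.assoc)

lemma mmult_mscale_right: "mmult N A (mscale c B) = mscale c (mmult N A B)"
  by (simp add: mmult_def mscale_def sum_distrib_left mult.left_commute)

lemmas mat_simps = madj_madd madj_mscale mmult_madd_left mmult_madd_right
  mmult_mscale_left mmult_mscale_right

lemma unital_star_subalg_mats: "unital_star_subalg N (mats N)"
  by (simp add: unital_star_subalg_def mats_mone mats_madd mats_mscale mats_mmult mats_madj)

lemma unitary_in_mats: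
  "unital_star_subalg N M \<Longrightarrow> unitary_in N M U \<Longrightarrow> unitary_in N (mats N) U"
  by (auto simp: unital_star_subalg_def unitary_in_def)

lemma unitary_in_mone: "unitary_in N (mats N) (mone N)"
  by (simp add: unitary_in_def mats_mone madj_mone mmult_mone_left)

lemma unitary_in_mmult:
  assumes "unitary_in N (mats N) U" and "unitary_in N (mats N) V"
  shows "unitary_in N (mats N) (mmult N U V)"
  unfolding unitary_in_def
proof (intro conjI)
  show "mmult N U V \<in> mats N"
    using assms by (simp add: unitary_in_def mats_mmult)
  have "mmult N (madj (mmult N U V)) (mmult N U V)
      = mmult N (madj V) (mmult N (mmult N (madj U) U) V)"
    by (simp add: madj_mmult mmult_assoc)
  then show "mmult N (madj (mmult N U V)) (mmult N U V) = mone N"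
    using assms by (simp add: unitary_in_def mmult_mone_left)
  have "mmult N (mmult N U V) (madj (mmult N U V))
      = mmult N U (mmult N (mmult N V (madj V)) (madj U))"
    by (simp add: madj_mmult mmult_assoc)
  then show "mmult N (mmult N U V) (madj (mmult N U V)) = mone N"
    using assms by (simp add: unitary_in_def mmult_mone_left mats_madj)
qed

lemma unitary_in_madj: "unitary_in N (mats N) U \<Longrightarrow> unitary_in N (mats N) (madj U)"
  by (simp add: unitary_in_def mats_madj madj_madj)

lemma unitary_in_mscale:
  assumes "unitary_in N (mats N) U" and "cmod z = 1"
  shows "unitary_in N (mats N) (mscale z U)"
proof -
  have "cnj z * z = 1" "z * cnj z = 1"
    using assms(2) complex_norm_square[of z] by (simp_all add: mult.commute)
  then have *: "cnj z * (z * w) = w" "z * (cnj z * w) = w" for w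
    by (metis mult.assoc mult_1)+
  have "mscale (cnj z) (mscale z A) = A" "mscale z (mscale (cnj z) A) = A" for A
    by (simp_all add: mscale_def *)
  then show ?thesis
    using assms(1) by (simp add: unitary_in_def mats_mscale mat_simps)
qed

section \<open>Determinant obstruction\<close>

text \<open>Cutting out the leading block passes from functions on pairs of naturals to a matrix
  type with a multiplicative determinant.\<close>

definition mdet :: "nat \<Rightarrow> cmat \<Rightarrow> complex" where
  "mdet N A = Determinant.det (mat N N (\<lambda>(i, j). A i j))"

lemma mdet_mmult: "mdet N (mmult N A B) = mdet N A * mdet N B"
proof -
  have "mat N N (\<lambda>(i, j). mmult N A B i j)
      = mat N N (\<lambda>(i, j). A i j) * mat N N (\<lambda>(i, j). B i j)"
    by (intro eq_matI) (auto simp: mmult_def scalar_prod_def lessThan_atLeast0)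
  then show ?thesis
    unfolding mdet_def by (simp add: Determinant.det_mult[where n = N])
qed

lemma mdet_mone: "mdet N (mone N) = 1"
proof -
  have "mat N N (\<lambda>(i, j). mone N i j) = 1\<^sub>m N"
    by (intro eq_matI) (auto simp: mone_def)
  then show ?thesis by (simp add: mdet_def)
qed

lemma mdet_mscale: "mdet N (mscale c A) = c ^ N * mdet N A"
proof -
  have "mat N N (\<lambda>(i, j). mscale c A i j) = c \<cdot>\<^sub>m mat N N (\<lambda>(i, j). A i j)"
    by (intro eq_matI) (auto simp: mscale_def)
  then show ?thesis by (simp add: mdet_def)
qed

text \<open>Unitarity of \<open>(U + \<i>X) / sqrt 2\<close> makes the unitary \<open>U\<^sup>*X\<close> Hermitian, so its determinant is real.\<close>

lemma mdet_square_eq: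
  assumes U: "unitary_in N (mats N) U" and X: "unitary_in N (mats N) X"
    and V: "unitary_in N (mats N) V"
    and rel: "mscale (sqrt 2) V = madd U (mscale \<i> X)"
  shows "(mdet N X)\<^sup>2 = (mdet N U)\<^sup>2"
proof -
  have "mmult N (madj (mscale (sqrt 2) V)) (mscale (sqrt 2) V) = mscale 2 (mone N)"
    using V by (simp add: unitary_in_def mat_simps) (simp add: mscale_def mult.assoc[symmetric]
        of_real_mult[symmetric] del: of_real_mult)
  \<comment> \<open>The same product expanded through \<open>rel\<close>: U^* U and X^* X already
    add up to twice the identity, so the cross terms i U^* X and - i X^* U must cancel.\<close>
  then have "madd (madd (mmult N (madj U) U) (mscale \<i> (mmult N (madj U) X)))
      (mscale (- \<i>) (madd (mmult N (madj X) U) (mscale \<i> (mmult N (madj X) X)))) = mscale 2 (mone N)"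
    unfolding rel mat_simps by (simp add: madd_def mscale_def algebra_simps fun_eq_iff)
  then have "mmult N (madj U) X = mmult N (madj X) U"
    using U X by (simp add: unitary_in_def madd_def mscale_def algebra_simps fun_eq_iff)
  then have eq: "mdet N (madj U) * mdet N X = mdet N (madj X) * mdet N U"
    by (metis mdet_mmult)
  have inv: "mdet N (madj U) * mdet N U = 1" "mdet N (madj X) * mdet N X = 1"
    using U X by (metis unitary_in_def mdet_mmult mdet_mone)+
  then have "(mdet N X)\<^sup>2 = (mdet N X * mdet N U) * (mdet N (madj U) * mdet N X)"
    by (simp add: power2_eq_square algebra_simps)
  also have "\<dots> = (mdet N U)\<^sup>2 * (mdet N (madj X) * mdet N X)"
    unfolding eq by (simp add: power2_eq_square algebra_simps)
  finally show ?thesis using inv by simp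
qed

text \<open>With \<open>d\<^sub>r = det (U r)\<close>, the chain of relations gives \<open>d\<^sub>0\<^sup>2 = d\<^sub>1\<^sup>2 = d\<^sub>2\<^sup>2 = d\<^sub>3\<^sup>2 = z\<^sup>2\<^sup>N d\<^sub>0\<^sup>2\<close>.\<close>

lemma cyclic_relations_root_of_unity:
  assumes U: "\<And>r. r < 4 \<Longrightarrow> unitary_in N (mats N) (U r)"
    and V: "\<And>r. r < 4 \<Longrightarrow> unitary_in N (mats N) (V r)"
    and z: "cmod z = 1"
    and rel: "\<And>r. r < 3 \<Longrightarrow> mscale (sqrt 2) (V r) = madd (U r) (mscale \<i> (U (Suc r)))"
    and rel': "mscale (sqrt 2) (V 3) = madd (U 3) (mscale \<i> (mscale z (U 0)))"
  shows "z ^ (2 * N) = 1"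
proof -
  have step: "(mdet N (U (Suc r)))\<^sup>2 = (mdet N (U r))\<^sup>2" if "r < 3" for r
    using mdet_square_eq[OF _ _ _ rel[OF that]] U V that by simp
  have "(mdet N (U 3))\<^sup>2 = (mdet N (U 0))\<^sup>2"
    using step[of 0] step[of 1] step[of 2] by (simp add: numeral_3_eq_3 numeral_2_eq_2)
  \<comment> \<open>In the closing relation z U_0 plays the role of X; its determinant z^N det U_0
    is the only source of the factor z^(2N).\<close>
  moreover have "(mdet N (mscale z (U 0)))\<^sup>2 = (mdet N (U 3))\<^sup>2"
    by (rule mdet_square_eq[OF _ _ _ rel']) (use U V z in \<open>simp_all add: unitary_in_mscale\<close>)
  ultimately have "z ^ (2 * N) * (mdet N (U 0))\<^sup>2 = (mdet N (U 0))\<^sup>2"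
    by (simp add: mdet_mscale power_mult_distrib power_mult[symmetric] mult.commute)
  moreover have "mdet N (U 0) \<noteq> 0"
  proof
    assume "mdet N (U 0) = 0"
    then have "mdet N (mmult N (madj (U 0)) (U 0)) = 0" by (simp add: mdet_mmult)
    then show False using U[of 0] by (simp add: unitary_in_def mdet_mone)
  qed
  ultimately show ?thesis by simp
qed

section \<open>Linear relations read off a Gram matrix\<close>

text \<open>On a Gram matrix of unitaries U_i this is the trace of X^* X, where X is the sum of c_i
  U_i. Summing over pairs makes it a single linear combination of the products U_j^* U_i.\<close>

definition gram_form :: "('n::finite \<Rightarrow> complex) \<Rightarrow> complex ^ 'n ^ 'n \<Rightarrow> complex" where
  "gram_form c a = (\<Sum>(i, j)\<in>UNIV. c i * cnj (c j) * a $ i $ j)"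

lemma zero_in_subalg:
  assumes "unital_star_subalg N M"
  shows "(\<lambda>p q. 0) \<in> M"
proof -
  have "mscale 0 (mone N) \<in> M" using assms by (simp add: unital_star_subalg_def)
  then show ?thesis by (simp add: mscale_def)
qed

lemma state_zero:
  assumes "unital_star_subalg N M" "faithful_tracial_state N M \<tau>"
  shows "\<tau> (\<lambda>p q. 0) = 0"
proof -
  have "\<tau> (mscale 0 (mone N)) = 0 * \<tau> (mone N)"
    using assms unfolding unital_star_subalg_def faithful_tracial_state_def by blast
  then show ?thesis by (simp add: mscale_def)
qed

text \<open>\<open>\<tau>\<close> is linear only on elements of \<open>M\<close>, so membership and
  value have to go through one induction together.\<close>

lemma lincomb_in_subalg:
  assumes M: "unital_star_subalg N M" and \<tau>: "faithful_tracial_state N M \<tau>"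
    and "finite S" and A: "\<And>i. A i \<in> M"
  shows "(\<lambda>p q. \<Sum>i\<in>S. c i * A i p q) \<in> M
    \<and> \<tau> (\<lambda>p q. \<Sum>i\<in>S. c i * A i p q) = (\<Sum>i\<in>S. c i * \<tau> (A i))"
  using \<open>finite S\<close>
proof (induction S rule: finite_induct)
  case empty
  then show ?case using zero_in_subalg[OF M] state_zero[OF M \<tau>] by simp
next
  case (insert x S)
  let ?R = "\<lambda>p q. \<Sum>i\<in>S. c i * A i p q"
  have eq: "(\<lambda>p q. \<Sum>i\<in>insert x S. c i * A i p q) = madd (mscale (c x) (A x)) ?R"
    using insert.hyps by (simp add: madd_def mscale_def)
  have "mscale (c x) (A x) \<in> M" "madd (mscale (c x) (A x)) ?R \<in> M"
    using M A insert.IH by (simp_all add: unital_star_subalg_def)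
  then show ?case
    unfolding eq using \<tau> A insert by (simp add: faithful_tracial_state_def)
qed

text \<open>Faithfulness turns trace zero of X^* X into X = 0. Hence the Gram matrix alone decides
  which linear relations hold, in every algebra and trace realising it.\<close>

lemma gram_form_zero_iff:
  fixes U :: "'n::finite \<Rightarrow> cmat" and c :: "'n \<Rightarrow> complex"
  assumes M: "unital_star_subalg N M" and \<tau>: "faithful_tracial_state N M \<tau>"
    and U: "\<And>i. U i \<in> M"
    and a: "\<And>i j. a $ i $ j = \<tau> (mmult N (madj (U j)) (U i))"
  shows "gram_form c a = 0 \<longleftrightarrow> (\<lambda>p q. \<Sum>i\<in>UNIV. c i * U i p q) = (\<lambda>p q. 0)"
proof -
  let ?X = "\<lambda>p q. \<Sum>i\<in>UNIV. c i * U i p q"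
  define C where "C = (\<lambda>(i, j). c i * cnj (c j))"
  define A where "A = (\<lambda>(i, j). mmult N (madj (U j)) (U i))"
  have A: "A k \<in> M" for k
    using M U by (cases k) (simp add: A_def unital_star_subalg_def)
  have X: "?X \<in> M"
    using lincomb_in_subalg[OF M \<tau> _ U, of UNIV c "\<lambda>i. i"] by simp
  have "mmult N (madj ?X) ?X = (\<lambda>p q. \<Sum>k\<in>UNIV. C k * A k p q)"
  proof (intro ext)
    fix p q
    have "mmult N (madj ?X) ?X p q
        = (\<Sum>l<N. \<Sum>j\<in>UNIV. \<Sum>i\<in>UNIV. cnj (c j * U j l p) * (c i * U i l q))"
      by (simp add: mmult_def madj_def sum_product)
    also have "\<dots> = (\<Sum>j\<in>UNIV. \<Sum>i\<in>UNIV. \<Sum>l<N. cnj (c j * U j l p) * (c i * U i l q))"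
      by (subst sum.swap, intro sum.cong refl, subst sum.swap, rule refl)
    also have "\<dots> = (\<Sum>i\<in>UNIV. \<Sum>j\<in>UNIV. C (i, j) * A (i, j) p q)"
      by (subst sum.swap)
        (simp add: C_def A_def mmult_def madj_def sum_distrib_left mult_ac)
    also have "\<dots> = (\<Sum>k\<in>UNIV. C k * A k p q)"
      by (simp add: sum.cartesian_product flip: UNIV_Times_UNIV)
    finally show "mmult N (madj ?X) ?X p q = (\<Sum>k\<in>UNIV. C k * A k p q)" .
  qed
  then have "\<tau> (mmult N (madj ?X) ?X) = (\<Sum>k\<in>UNIV. C k * \<tau> (A k))"
    using lincomb_in_subalg[OF M \<tau> _ A, of UNIV C] by simp
  also have "\<dots> = gram_form c a"
    unfolding gram_form_def by (intro sum.cong) (auto simp: C_def A_def a)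
  finally have eq: "\<tau> (mmult N (madj ?X) ?X) = gram_form c a" .
  show ?thesis
  proof
    assume "gram_form c a = 0"
    then show "?X = (\<lambda>p q. 0)" using eq \<tau> X by (simp add: faithful_tracial_state_def)
  next
    assume *: "?X = (\<lambda>p q. 0)"
    have "mmult N (madj ?X) ?X = (\<lambda>p q. 0)"
      unfolding * by (simp add: mmult_def madj_def)
    then show "gram_form c a = 0" using eq state_zero[OF M \<tau>] by simp
  qed
qed

text \<open>Coefficients of sqrt 2 U_i - U_j - i z U_k. With z = 1 this encodes an ordinary link of
  the chain, with general z the closing one.\<close>

definition mid_coeff :: "'n \<Rightarrow> 'n \<Rightarrow> 'n \<Rightarrow> complex \<Rightarrow> 'n \<Rightarrow> complex" where
  "mid_coeff i j k z l =
     (if l = i then complex_of_real (sqrt 2) else 0) - (if l = j then 1 else 0) - (if l = k then \<i> * z else 0)"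

lemma gram_form_mid_coeff_zero_iff:
  fixes U :: "'n::finite \<Rightarrow> cmat"
  assumes "unital_star_subalg N M" "faithful_tracial_state N M \<tau>" "\<And>i. U i \<in> M"
    and "\<And>i j. a $ i $ j = \<tau> (mmult N (madj (U j)) (U i))"
  shows "gram_form (mid_coeff i j k z) a = 0
    \<longleftrightarrow> mscale (sqrt 2) (U i) = madd (U j) (mscale \<i> (mscale z (U k)))"
proof -
  have "(\<Sum>l\<in>UNIV. mid_coeff i j k z l * U l p q)
      = sqrt 2 * U i p q - U j p q - \<i> * z * U k p q" for p q
    by (simp add: mid_coeff_def algebra_simps if_distrib[of "\<lambda>x. _ * x"]
        sum.distrib sum_subtractf cong: if_cong)
  then have "gram_form (mid_coeff i j k z) a = 0
      \<longleftrightarrow> (\<forall>p q. sqrt 2 * U i p q - U j p q - \<i> * z * U k p q = 0)"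
    unfolding gram_form_zero_iff[OF assms] fun_eq_iff by simp
  then show ?thesis
    by (simp add: madd_def mscale_def fun_eq_iff algebra_simps)
qed

text \<open>The form is polynomial in the entries of the matrix, the coefficients and their
  conjugates, so z may vary along with the matrix, as it does for the closing relation.\<close>

lemma tendsto_gram_form_mid_coeff:
  fixes a :: "nat \<Rightarrow> complex ^ 'n::finite ^ 'n"
  assumes "a \<longlonglongrightarrow> b" and "z \<longlonglongrightarrow> w"
  shows "(\<lambda>m. gram_form (mid_coeff i j k (z m)) (a m)) \<longlonglongrightarrow> gram_form (mid_coeff i j k w) b"
proof -
  have "(\<lambda>m. mid_coeff i j k (z m) l) \<longlonglongrightarrow> mid_coeff i j k w l" for l
    unfolding mid_coeff_def using assms(2) by (auto intro!: tendsto_intros)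
  then show ?thesis
    unfolding gram_form_def using assms(1)
    by (auto intro!: tendsto_sum tendsto_mult tendsto_cnj tendsto_vec_nth simp: split_beta)
qed

section \<open>The normalised trace\<close>

definition ntrace :: "nat \<Rightarrow> cmat \<Rightarrow> complex" where
  "ntrace N A = (\<Sum>i<N. A i i) / of_nat N"

text \<open>The normalised squared Frobenius norm: positivity and faithfulness of the trace both
  come from here.\<close>

lemma ntrace_madj_mmult:
  "ntrace N (mmult N (madj A) A) = of_real ((\<Sum>i<N. \<Sum>k<N. (cmod (A k i))\<^sup>2) / real N)"
  by (simp add: ntrace_def mmult_def madj_def complex_norm_square mult.commute del: of_real_power)

lemma faithful_tracial_state_ntrace:
  assumes "N > 0"
  shows "faithful_tracial_state N (mats N) (ntrace N)"
  unfolding faithful_tracial_state_def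
proof (intro conjI ballI allI impI)
  fix x y :: cmat
  show "ntrace N (madd x y) = ntrace N x + ntrace N y"
    by (simp add: ntrace_def madd_def sum.distrib add_divide_distrib)
  show "ntrace N (mscale c x) = c * ntrace N x" for c
    by (simp add: ntrace_def mscale_def sum_distrib_left)
  show "ntrace N (mone N) = 1"
    using assms by (simp add: ntrace_def mone_def)
  show "Im (ntrace N (mmult N (madj x) x)) = 0"
    by (simp add: ntrace_madj_mmult del: of_real_divide)
  show "Re (ntrace N (mmult N (madj x) x)) \<ge> 0"
    by (simp add: ntrace_madj_mmult sum_nonneg del: of_real_divide)
  have "(\<Sum>i<N. \<Sum>k<N. x i k * y k i) = (\<Sum>k<N. \<Sum>i<N. y k i * x i k)"
    by (subst sum.swap) (simp add: mult.commute)
  then show "ntrace N (mmult N x y) = ntrace N (mmult N y x)"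
    by (simp add: ntrace_def mmult_def)
next
  fix x assume x: "x \<in> mats N" and "ntrace N (mmult N (madj x) x) = 0"
  then have "(\<Sum>i<N. \<Sum>k<N. (cmod (x k i))\<^sup>2) = 0"
    using assms unfolding ntrace_madj_mmult of_real_eq_0_iff by simp
  then have "x k i = 0" if "i < N" "k < N" for i k
    using that by (simp add: sum_nonneg_eq_0_iff sum_nonneg)
  then have "x k i = 0" for i k
    using x by (cases "i < N \<and> k < N") (auto simp: mats_def)
  then show "x = (\<lambda>i j. 0)" by (intro ext)
qed

text \<open>Columns of a unitary are unit vectors, so each diagonal entry has modulus at most 1.
  This bounds Gram entries independently of the matrix size.\<close>

lemma norm_ntrace_unitary_le:
  assumes "unitary_in N (mats N) B"
  shows "cmod (ntrace N B) \<le> 1"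
proof -
  have "cmod (B i i) \<le> 1" if "i < N" for i
  proof -
    have "mmult N (madj B) B i i = of_real (\<Sum>k<N. (cmod (B k i))\<^sup>2)"
      by (simp add: mmult_def madj_def complex_norm_square mult.commute del: of_real_power)
    moreover have "mmult N (madj B) B i i = 1"
      using assms that by (simp add: unitary_in_def mone_def)
    ultimately have "(\<Sum>k<N. (cmod (B k i))\<^sup>2) = 1"
      by (metis of_real_eq_1_iff)
    moreover have "(cmod (B i i))\<^sup>2 \<le> (\<Sum>k<N. (cmod (B k i))\<^sup>2)"
      using that by (intro member_le_sum) auto
    ultimately show ?thesis by (simp add: power_le_one_iff abs_square_le_1)
  qed
  then have "cmod (\<Sum>i<N. B i i) \<le> real (card {..<N}) * 1"
    by (intro order_trans[OF norm_sum] sum_bounded_above) auto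
  \<comment> \<open>For N = 0 the trace is 0 by the convention for division by zero.\<close>
  then show ?thesis
    by (cases "N = 0") (simp_all add: ntrace_def norm_divide divide_le_eq)
qed

text \<open>A crude bound is enough: it only has to be uniform, so that a convergent subsequence can
  be extracted.\<close>

lemma norm_matrix_le:
  fixes a :: "complex ^ 'n::finite ^ 'n"
  assumes "\<And>i j. cmod (a $ i $ j) \<le> 1"
  shows "norm a \<le> real CARD('n) * real CARD('n)"
proof -
  have "norm (a $ i) \<le> real CARD('n)" for i
  proof -
    have "norm (a $ i) \<le> (\<Sum>j\<in>UNIV. cmod (a $ i $ j))"
      unfolding norm_vec_def by (rule L2_set_le_sum) simp
    also have "\<dots> \<le> real CARD('n) * 1"
      using assms by (intro sum_bounded_above)
    finally show ?thesis by simp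
  qed
  then have "(\<Sum>i\<in>UNIV. norm (a $ i)) \<le> real CARD('n) * real CARD('n)"
    by (intro sum_bounded_above)
  moreover have "norm a \<le> (\<Sum>i\<in>UNIV. norm (a $ i))"
    unfolding norm_vec_def by (rule L2_set_le_sum) simp
  ultimately show ?thesis by linarith
qed

section \<open>Four symmetries with scalar product\<close>

definition symmetry_in :: "nat \<Rightarrow> cmat \<Rightarrow> bool" where
  "symmetry_in N s \<longleftrightarrow> s \<in> mats N \<and> madj s = s \<and> mmult N s s = mone N"

text \<open>The operator sending the basis vector e_j to \<phi>(j) e_(\<sigma>(j)): a weighted
  permutation matrix whenever \<sigma> permutes the indices below N.\<close>

definition monomial_mat :: "nat \<Rightarrow> (nat \<Rightarrow> nat) \<Rightarrow> (nat \<Rightarrow> complex) \<Rightarrow> cmat" where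
  "monomial_mat N \<sigma> \<phi> = (\<lambda>i j. if j < N \<and> i = \<sigma> j then \<phi> j else 0)"

lemma mmult_monomial_mat:
  assumes "\<And>x. x < N \<Longrightarrow> \<rho> x < N"
  shows "mmult N (monomial_mat N \<sigma> \<phi>) (monomial_mat N \<rho> \<psi>)
    = monomial_mat N (\<sigma> \<circ> \<rho>) (\<lambda>x. \<phi> (\<rho> x) * \<psi> x)"
proof (intro ext)
  fix i j
  have "mmult N (monomial_mat N \<sigma> \<phi>) (monomial_mat N \<rho> \<psi>) i j
      = (\<Sum>k<N. if k = \<rho> j then (if j < N \<and> i = \<sigma> (\<rho> j) then \<phi> (\<rho> j) * \<psi> j else 0) else 0)"
    unfolding mmult_def monomial_mat_def by (intro sum.cong) auto
  then show "mmult N (monomial_mat N \<sigma> \<phi>) (monomial_mat N \<rho> \<psi>) i j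
      = monomial_mat N (\<sigma> \<circ> \<rho>) (\<lambda>x. \<phi> (\<rho> x) * \<psi> x) i j"
    using assms by (auto simp: monomial_mat_def)
qed

lemma monomial_mat_eq_mscale_mone:
  assumes "\<And>x. x < N \<Longrightarrow> \<sigma> x = x" and "\<And>x. x < N \<Longrightarrow> \<phi> x = c"
  shows "monomial_mat N \<sigma> \<phi> = mscale c (mone N)"
  using assms by (intro ext) (auto simp: monomial_mat_def mscale_def mone_def)

text \<open>Conjugate weights at x and \<sigma>(x) give self-adjointness; the square then has the
  weight |\<phi>(\<sigma>(x))|^2 = 1 at x.\<close>

lemma symmetry_in_monomial_mat:
  assumes \<sigma>: "\<And>x. x < N \<Longrightarrow> \<sigma> x < N" and inv: "\<And>x. x < N \<Longrightarrow> \<sigma> (\<sigma> x) = x"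
    and herm: "\<And>x. x < N \<Longrightarrow> cnj (\<phi> (\<sigma> x)) = \<phi> x" and unit: "\<And>x. x < N \<Longrightarrow> cmod (\<phi> x) = 1"
  shows "symmetry_in N (monomial_mat N \<sigma> \<phi>)"
  unfolding symmetry_in_def
proof (intro conjI)
  show "monomial_mat N \<sigma> \<phi> \<in> mats N"
    using \<sigma> by (force simp: mats_def monomial_mat_def)
  show "madj (monomial_mat N \<sigma> \<phi>) = monomial_mat N \<sigma> \<phi>"
    using \<sigma> inv herm by (intro ext) (auto simp: madj_def monomial_mat_def)
  have "\<phi> (\<sigma> x) * \<phi> x = 1" if "x < N" for x
    using herm[OF that] unit[OF \<sigma>[OF that]] complex_norm_square[of "\<phi> (\<sigma> x)"] by simp
  then have "monomial_mat N (\<sigma> \<circ> \<sigma>) (\<lambda>x. \<phi> (\<sigma> x) * \<phi> x) = mscale 1 (mone N)"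
    using inv by (intro monomial_mat_eq_mscale_mone) auto
  then show "mmult N (monomial_mat N \<sigma> \<phi>) (monomial_mat N \<sigma> \<phi>) = mone N"
    using \<sigma> by (simp add: mmult_monomial_mat mscale_def)
qed

lemma power_mod_root_of_unity:
  fixes \<mu> :: complex
  assumes "\<mu> ^ N = 1"
  shows "\<mu> ^ (k mod N) = \<mu> ^ k"
proof -
  have "\<mu> ^ k = (\<mu> ^ N) ^ (k div N) * \<mu> ^ (k mod N)"
    by (simp flip: power_mult power_add)
  then show ?thesis using assms by simp
qed

text \<open>Modulo N this is c - (c - x) = x; the summand N keeps subtraction on naturals from
  truncating. Wrap-around occurs only for x at most c, which leaves few cases when c is 0 or
  1.\<close>

lemma reflection_mod:
  fixes N c x :: nat
  assumes "x < N" and "c \<le> 1"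
  shows "(N + c - (N + c - x) mod N) mod N = x"
proof -
  have "x \<le> c \<or> c < x" by auto
  then show ?thesis
  proof
    assume "c < x"
    then have "(N + c - x) mod N = N + c - x" using assms by (intro mod_less) auto
    then show ?thesis using assms by simp
  next
    assume "x \<le> c"
    then consider "x = c" | "x = 0" "c = 1" using assms by linarith
    then show ?thesis
    proof cases
      case 1
      then show ?thesis using assms by simp
    next
      case 2
      then show ?thesis using assms by (cases "N = 1") auto
    qed
  qed
qed

text \<open>Reflections of \<open>\<int>/N\<close>, twisted by characters: the representation of the crossed product of the
  rotation algebra by the flip at the rational parameter given by \<open>z\<close>.\<close>

lemma four_symmetries:
  assumes N: "N > 0" and z: "cmod z = 1" "z ^ (2 * N) = 1"
  obtains s1 s2 s3 s4 where
    "symmetry_in N s1" "symmetry_in N s2" "symmetry_in N s3" "symmetry_in N s4"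
    "mmult N (mmult N (mmult N s1 s2) s3) s4 = mscale z (mone N)"
proof -
  \<comment> \<open>While z is only a 2N-th root of unity, its square is an N-th one, so powers of
    \<mu> are characters of Z/N.\<close>
  define \<mu> where "\<mu> = z\<^sup>2"
  have \<mu>N: "\<mu> ^ N = 1" using z by (simp add: \<mu>_def flip: power_mult)
  have zz: "cnj z * z = 1"
    using z complex_norm_square[of z] by (simp add: mult.commute)
  have \<mu>\<mu>: "cnj \<mu> * \<mu> = 1"
    using zz by (metis \<mu>_def complex_cnj_power power_mult_distrib power_one)
  have \<mu>_norm: "cmod \<mu> = 1" using z by (simp add: \<mu>_def norm_power)
  \<comment> \<open>The conjugate of \<mu> is its inverse and stands in for negative
    exponents.\<close>
  have pow: "\<mu> ^ (N + c - x) = \<mu> ^ c * cnj \<mu> ^ x" if "x < N" for c x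
  proof -
    have "\<mu> ^ (N + c - x) * (\<mu> ^ x * cnj \<mu> ^ x) = \<mu> ^ (N + c) * cnj \<mu> ^ x"
      using that by (simp flip: power_add mult.assoc)
    then show ?thesis
      using \<mu>N \<mu>\<mu> by (simp add: power_add mult.commute flip: power_mult_distrib)
  qed
  define \<sigma> where "\<sigma> c x = (N + c - x) mod N" for c x
  have \<sigma>_less: "\<sigma> c x < N" for c x using N by (simp add: \<sigma>_def)
  have \<sigma>_inv: "\<sigma> c (\<sigma> c x) = x" if "x < N" "c \<le> 1" for c x
    unfolding \<sigma>_def using reflection_mod that by blast
  have \<mu>\<sigma>: "\<mu> ^ \<sigma> c x = \<mu> ^ c * cnj \<mu> ^ x" if "x < N" for c x
    unfolding \<sigma>_def using pow[OF that] power_mod_root_of_unity[OF \<mu>N] by simp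
  define s1 where "s1 = monomial_mat N (\<sigma> 0) (\<lambda>x. 1)"
  define s2 where "s2 = monomial_mat N (\<sigma> 1) (\<lambda>x. 1)"
  \<comment> \<open>The reflections of \<open>s1\<close>, ..., \<open>s4\<close> compose to the
    identity. The characters in \<open>s3\<close> and \<open>s4\<close> are chosen to cancel in the
    product, leaving only the weight z.\<close>
  define s3 where "s3 = monomial_mat N (\<sigma> 1) (\<lambda>x. z * cnj \<mu> ^ x)"
  define s4 where "s4 = monomial_mat N (\<sigma> 0) (\<lambda>x. cnj \<mu> ^ x)"
  have "symmetry_in N s1" "symmetry_in N s2"
    unfolding s1_def s2_def by (intro symmetry_in_monomial_mat; simp add: \<sigma>_less \<sigma>_inv)+
  moreover have "symmetry_in N s4"
    unfolding s4_def
    by (intro symmetry_in_monomial_mat) (simp_all add: \<sigma>_less \<sigma>_inv \<mu>\<sigma> norm_power \<mu>_norm)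
  moreover have "symmetry_in N s3"
  proof -
    \<comment> \<open>The reflection x to 1 - x costs a factor \<mu> in the Hermitian condition; the
      prefactor z, a square root of \<mu>, absorbs it.\<close>
    have "cnj z * \<mu> = z" using zz by (simp add: \<mu>_def power2_eq_square flip: mult.assoc)
    then show ?thesis
      unfolding s3_def
      by (intro symmetry_in_monomial_mat)
        (simp_all add: \<sigma>_less \<sigma>_inv \<mu>\<sigma> norm_power norm_mult \<mu>_norm z flip: mult.assoc)
  qed
  moreover have "mmult N (mmult N (mmult N s1 s2) s3) s4 = mscale z (mone N)"
    unfolding s1_def s2_def s3_def s4_def
  proof (simp add: mmult_monomial_mat \<sigma>_less, rule monomial_mat_eq_mscale_mone)
    fix x assume x: "x < N"
    then show "(\<sigma> 0 \<circ> \<sigma> (Suc 0) \<circ> \<sigma> (Suc 0) \<circ> \<sigma> 0) x = x"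
      by (simp add: \<sigma>_less \<sigma>_inv)
    \<comment> \<open>\<open>s4\<close> contributes its character at x and moves x to -x, where
      \<open>s3\<close> contributes the inverse value.\<close>
    have "cnj (\<mu> ^ \<sigma> 0 x) * cnj (\<mu> ^ x) = 1"
      using x \<mu>\<mu> by (simp add: \<mu>\<sigma> mult.commute flip: power_mult_distrib)
    then show "z * cnj \<mu> ^ \<sigma> 0 x * cnj \<mu> ^ x = z" by (simp add: mult.assoc)
  qed
  ultimately show thesis using that by blast
qed

section \<open>From symmetries to unitaries satisfying the cyclic relations\<close>

lemma unitary_in_symmetry: "symmetry_in N s \<Longrightarrow> unitary_in N (mats N) s"
  by (simp add: symmetry_in_def unitary_in_def)

text \<open>For a symmetry s this is exp(i pi s / 4), hence unitary: (1 - i s)(1 + i s) = 1 + s^2 =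
  2.\<close>

definition half_rotation :: "nat \<Rightarrow> cmat \<Rightarrow> cmat" where
  "half_rotation N s = mscale (1 / sqrt 2) (madd (mone N) (mscale \<i> s))"

lemma mscale_mmult_half_rotation:
  assumes "U \<in> mats N"
  shows "mscale (sqrt 2) (mmult N U (half_rotation N s)) = madd U (mscale \<i> (mmult N U s))"
  using assms unfolding half_rotation_def mat_simps
  by (simp add: mmult_mone_right) (simp add: mscale_def madd_def)

lemma unitary_in_half_rotation:
  assumes "symmetry_in N s"
  shows "unitary_in N (mats N) (half_rotation N s)"
proof -
  have s: "s \<in> mats N" "madj s = s" "mmult N s s = mone N"
    using assms by (auto simp: symmetry_in_def)
  have *: "complex_of_real (sqrt 2) * complex_of_real (sqrt 2) = 2"
    by (simp flip: of_real_mult)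
  show ?thesis
    unfolding unitary_in_def half_rotation_def mat_simps
    using s by (simp add: mats_mscale mats_madd mats_mone madj_mone mmult_mone_left
        mmult_mone_right) (auto simp: mscale_def madd_def fun_eq_iff field_simps *)
qed

text \<open>The U_r are the partial products of the four symmetries, and V_r is U_r times a half
  rotation. The full product z closes the cycle: U_3 s_4 = z U_0. Indices 0 to 3 of \<open>T\<close>
  hold the U_r, 4 to 7 the V_r.\<close>

lemma cyclic_relations_exist:
  assumes "N > 0" "cmod z = 1" "z ^ (2 * N) = 1"
  obtains T :: "nat \<Rightarrow> cmat" where
    "\<And>r. unitary_in N (mats N) (T r)"
    "\<And>r. r < 3 \<Longrightarrow> mscale (sqrt 2) (T (4 + r)) = madd (T r) (mscale \<i> (T (Suc r)))"
    "mscale (sqrt 2) (T 7) = madd (T 3) (mscale \<i> (mscale z (T 0)))"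
proof -
  from four_symmetries[OF assms] obtain s1 s2 s3 s4 where
    s: "symmetry_in N s1" "symmetry_in N s2" "symmetry_in N s3" "symmetry_in N s4"
    and prod: "mmult N (mmult N (mmult N s1 s2) s3) s4 = mscale z (mone N)" .
  define P where "P = [mone N, s1, mmult N s1 s2, mmult N (mmult N s1 s2) s3]"
  define H where "H = map (half_rotation N) [s1, s2, s3, s4]"
  define Q where "Q = map2 (mmult N) P H"
  \<comment> \<open>The default value makes \<open>T r\<close> unitary for every r, so that it can
    also fill matrix indices beyond the eight used.\<close>
  define T where "T r = (if r < 8 then (P @ Q) ! r else mone N)" for r
  note u = unitary_in_mone unitary_in_mmult unitary_in_symmetry unitary_in_half_rotation s
  have "\<forall>A \<in> set (P @ Q). unitary_in N (mats N) A"
    by (simp add: P_def Q_def H_def u)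
  moreover have "length (P @ Q) = 8" by (simp add: P_def Q_def H_def)
  ultimately have T: "unitary_in N (mats N) (T r)" for r
    unfolding T_def by (metis nth_mem u(1))
  have mem: "mone N \<in> mats N" "s1 \<in> mats N" "mmult N s1 s2 \<in> mats N"
    "mmult N (mmult N s1 s2) s3 \<in> mats N"
    using s by (simp_all add: symmetry_in_def mats_mone mats_mmult)
  show thesis
  proof (rule that[of T])
    show "unitary_in N (mats N) (T r)" for r by (rule T)
    show "mscale (sqrt 2) (T (4 + r)) = madd (T r) (mscale \<i> (T (Suc r)))" if r: "r < 3" for r
    proof -
      consider "r = 0" | "r = 1" | "r = 2" using r by linarith
      then show ?thesis
        by cases (use mem in \<open>simp_all add: T_def P_def Q_def H_def mscale_mmult_half_rotation
            mmult_mone_left\<close>)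
    qed
    show "mscale (sqrt 2) (T 7) = madd (T 3) (mscale \<i> (mscale z (T 0)))"
      using mem prod by (simp add: T_def P_def Q_def H_def mscale_mmult_half_rotation)
  qed
qed

section \<open>Rational approximation\<close>

text \<open>The error is at most 1/(k+1). The denominator k+1 will also be the size of the matrices
  in the k-th model.\<close>

lemma floor_div_tendsto:
  fixes t :: real
  shows "(\<lambda>k. of_int \<lfloor>real (Suc k) * t\<rfloor> / real (Suc k)) \<longlonglongrightarrow> t"
proof (rule tendsto_sandwich)
  have *: "real_of_int \<lfloor>real (Suc k) * t\<rfloor> / real (Suc k) \<le> t"
    "t - 1 / real (Suc k) \<le> real_of_int \<lfloor>real (Suc k) * t\<rfloor> / real (Suc k)" for k
  proof -
    show "real_of_int \<lfloor>real (Suc k) * t\<rfloor> / real (Suc k) \<le> t"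
      using of_int_floor_le[of "real (Suc k) * t"] by (simp add: divide_le_eq mult.commute)
    have "real (Suc k) * t - 1 \<le> real_of_int \<lfloor>real (Suc k) * t\<rfloor>"
      by linarith
    then have "(real (Suc k) * t - 1) / real (Suc k) \<le> real_of_int \<lfloor>real (Suc k) * t\<rfloor> / real (Suc k)"
      by (rule divide_right_mono) simp
    then show "t - 1 / real (Suc k) \<le> real_of_int \<lfloor>real (Suc k) * t\<rfloor> / real (Suc k)"
      by (simp add: diff_divide_distrib del: of_nat_Suc)
  qed
  show "\<forall>\<^sub>F k in sequentially. t - 1 / real (Suc k) \<le> of_int \<lfloor>real (Suc k) * t\<rfloor> / real (Suc k)"
    using * by (intro always_eventually) blast
  show "\<forall>\<^sub>F k in sequentially. of_int \<lfloor>real (Suc k) * t\<rfloor> / real (Suc k) \<le> t"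
    using * by (intro always_eventually) blast
  have "(\<lambda>k. t - 1 / real (Suc k)) \<longlonglongrightarrow> t - 0"
    by (intro tendsto_diff tendsto_const LIMSEQ_Suc lim_1_over_n)
  then show "(\<lambda>k. t - 1 / real (Suc k)) \<longlonglongrightarrow> t" by simp
qed simp

text \<open>The angle 2 N pi t must be a multiple of 2 pi, so N t is an integer.\<close>

lemma cis_pi_root_of_unity_imp_rat:
  assumes "cis (pi * t) ^ (2 * N) = 1" and "N > 0"
  shows "t \<in> \<rat>"
proof -
  have "cis (2 * real N * (pi * t)) = 1"
    using assms(1) unfolding Complex.DeMoivre by (simp add: mult_ac)
  then have "cos (2 * real N * (pi * t)) = 1"
    by (metis Re_complex_of_real cis.sel(1) one_complex.sel(1))
  then obtain n :: int where "2 * real N * (pi * t) = of_int n * 2 * pi"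
    unfolding cos_one_2pi_int by blast
  then have "t = of_int n / of_int (int N)"
    using assms(2) by (simp add: field_simps)
  then show ?thesis by auto
qed

lemma ex_irrational: "\<exists>t::real. t \<notin> \<rat>"
  using uncountable_UNIV_real countable_rat by (metis UNIV_eq_I)

section \<open>Limit of Gram matrices along roots of unity\<close>

theorem theorem2p3:
  assumes "CARD('n::finite) \<ge> 8"
  shows "\<not> closed (F_fin :: (complex ^ 'n ^ 'n) set)"
proof
  assume closed: "closed (F_fin :: (complex ^ 'n ^ 'n) set)"
  obtain t :: real where t: "t \<notin> \<rat>" using ex_irrational by blast
  obtain e :: "nat \<Rightarrow> 'n" where e: "inj_on e {..<8}"
    using card_le_inj[of "{..<8::nat}" "UNIV :: 'n set"] assms by auto
  \<comment> \<open>Off the image of \<open>e\<close> the value of \<open>h\<close> is arbitrary,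
    which is harmless because \<open>T\<close> is unitary everywhere.\<close>
  define h where "h = inv_into {..<8} e"
  have h: "h (e r) = r" if "r < 8" for r
    unfolding h_def using e that by (simp add: inv_into_f_f)
  \<comment> \<open>The four cyclic relations, phrased as vanishing of continuous functions of z and
    the matrix so that they survive limits.\<close>
  define R where "R z a \<longleftrightarrow> (\<forall>r<3. gram_form (mid_coeff (e (4 + r)) (e r) (e (Suc r)) 1) a = 0)
    \<and> gram_form (mid_coeff (e 7) (e 3) (e 0) z) a = 0" for z and a :: "complex ^ 'n ^ 'n"
  \<comment> \<open>The angle is pi times a fraction with denominator k+1, so \<open>z k\<close> is
    a 2(k+1)-th root of unity and has a model of size k+1.\<close>
  define z where "z k = cis (pi * (of_int \<lfloor>real (Suc k) * t\<rfloor> / real (Suc k)))" for k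
  have z_lim: "z \<longlonglongrightarrow> cis (pi * t)"
    unfolding z_def by (intro tendsto_intros floor_div_tendsto)
  have "\<exists>a. a \<in> F_fin \<and> R (z k) a \<and> (\<forall>i j. cmod (a $ i $ j) \<le> 1)" for k
  proof -
    let ?N = "Suc k"
    have "real (2 * ?N) * (pi * (of_int \<lfloor>real ?N * t\<rfloor> / real ?N))
        = 2 * pi * of_int \<lfloor>real ?N * t\<rfloor>"
      by (simp del: of_nat_Suc mult_Suc_right)
    then have "z k ^ (2 * ?N) = cis (2 * pi * of_int \<lfloor>real ?N * t\<rfloor>)"
      unfolding z_def Complex.DeMoivre by (rule arg_cong)
    then have "z k ^ (2 * ?N) = 1" by simp
    then obtain T :: "nat \<Rightarrow> cmat" where T: "\<And>r. unitary_in ?N (mats ?N) (T r)"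
      "\<And>r. r < 3 \<Longrightarrow> mscale (sqrt 2) (T (4 + r)) = madd (T r) (mscale \<i> (T (Suc r)))"
      "mscale (sqrt 2) (T 7) = madd (T 3) (mscale \<i> (mscale (z k) (T 0)))"
      using cyclic_relations_exist[of ?N "z k"] by (auto simp: z_def)
    define a :: "complex ^ 'n ^ 'n"
      where "a = (\<chi> i j. ntrace ?N (mmult ?N (madj (T (h j))) (T (h i))))"
    note M = unital_star_subalg_mats[of ?N] faithful_tracial_state_ntrace[of ?N, simplified]
    have a: "a $ i $ j = ntrace ?N (mmult ?N (madj (T (h j))) (T (h i)))" for i j
      by (simp add: a_def)
    have mem: "T (h i) \<in> mats ?N" for i
      using T(1) by (simp add: unitary_in_def)
    have "a \<in> F_fin"
      unfolding F_fin_def mem_Collect_eq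
      by (intro exI[where x = ?N] exI[where x = "mats ?N"] exI[where x = "ntrace ?N"]
          exI[where x = "\<lambda>i. T (h i)"] conjI M allI T(1) a)
    moreover have "cmod (a $ i $ j) \<le> 1" for i j
      unfolding a by (intro norm_ntrace_unitary_le unitary_in_mmult unitary_in_madj T)
    moreover have "R (z k) a"
      unfolding R_def gram_form_mid_coeff_zero_iff[OF M, of "\<lambda>i. T (h i)", OF mem a]
      using T(2,3) by (simp add: h mscale_def)
    ultimately show ?thesis by blast
  qed
  then obtain a :: "nat \<Rightarrow> complex ^ 'n ^ 'n" where a: "\<And>k. a k \<in> F_fin" "\<And>k. R (z k) (a k)"
    "\<And>k i j. cmod (a k $ i $ j) \<le> 1"
    by metis
  have "bounded (range a)"
    using norm_matrix_le[OF a(3)] by (auto simp: bounded_iff)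
  then obtain b r where r: "strict_mono r" and b: "(a \<circ> r) \<longlonglongrightarrow> b"
    using bounded_imp_convergent_subsequence by blast
  have "b \<in> F_fin"
    using closed_sequentially[OF closed _ b] a(1) by simp
  have "(z \<circ> r) \<longlonglongrightarrow> cis (pi * t)"
    using z_lim r by (rule LIMSEQ_subseq_LIMSEQ)
  \<comment> \<open>The first instance lets z move, for the closing relation; the second keeps it
    constant, for the other three.\<close>
  note lim = tendsto_gram_form_mid_coeff[OF b this] tendsto_gram_form_mid_coeff[OF b tendsto_const]
  have "R (cis (pi * t)) b"
    unfolding R_def
  proof (intro conjI allI impI)
    show "gram_form (mid_coeff (e (4 + s)) (e s) (e (Suc s)) 1) b = 0" if "s < 3" for s
      using lim(2)[of "e (4 + s)" "e s" "e (Suc s)" 1] a(2) that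
      by (simp add: R_def LIMSEQ_const_iff)
    show "gram_form (mid_coeff (e 7) (e 3) (e 0) (cis (pi * t))) b = 0"
      using lim(1)[of "e 7" "e 3" "e 0"] a(2) by (simp add: R_def LIMSEQ_const_iff)
  qed
  from \<open>b \<in> F_fin\<close> obtain N M \<tau> and U :: "'n \<Rightarrow> cmat" where
    M: "unital_star_subalg N M" "faithful_tracial_state N M \<tau>"
    and U: "\<And>i. unitary_in N M (U i)"
    and gram: "\<And>i j. b $ i $ j = \<tau> (mmult N (madj (U j)) (U i))"
    unfolding F_fin_def by blast
  \<comment> \<open>In size 0 the equation z^(2N) = 1 would be vacuous; there the unit is the zero
    matrix, against \<tau>(1) = 1.\<close>
  have "N > 0"
  proof (rule ccontr)
    assume "\<not> N > 0"
    then have "mone N = (\<lambda>p q. 0)" by (simp add: mone_def)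
    then show False using state_zero[OF M] M(2) by (simp add: faithful_tracial_state_def)
  qed
  have "U i \<in> M" for i using U by (simp add: unitary_in_def)
  \<comment> \<open>The realisation of \<open>b\<close> has its own size, algebra and trace, yet its
    unitaries inherit the relations since these depend on \<open>b\<close> only.\<close>
  note rel = \<open>R (cis (pi * t)) b\<close>[unfolded R_def gram_form_mid_coeff_zero_iff[OF M this gram]]
  have "cis (pi * t) ^ (2 * N) = 1"
  proof (rule cyclic_relations_root_of_unity[where U = "U \<circ> e" and V = "\<lambda>r. U (e (4 + r))"])
  qed (use rel unitary_in_mats[OF M(1) U] in \<open>auto simp: mscale_def\<close>)
  then show False
    using cis_pi_root_of_unity_imp_rat \<open>N > 0\<close> t by blast
qed

end
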